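(* Let $f_1(z)=1+\frac{z-1}{1+z}$ and $f_n(z)=1+\frac{z-1}{1+f_{n-1}(z)}$ for $n\ge 2$. Then for every $z\in\mathbb{C}$ with $\mathrm{Re}\,z>0$ the sequence $f_n(z)$ converges to $\sqrt{z}$ with convergence rate $\left(\frac{1-\sqrt{z}}{1+\sqrt{z}}\right)^n$; that is, there is a constant $C>0$ (depending on $z$ but not on $n$) such that for all $n\ge 1$ $$|f_n(z)-\sqrt{z}|\le C\left|\frac{1-\sqrt{z}}{1+\sqrt{z}}\right|^n,$$ and $f_n(z)\to\sqrt{z}$ as $n\to\infty$.
   Context: $\sqrt{z}$ denotes the principal branch of the square root on the right half-plane $\{\mathrm{Re}\,z>0\}$, i.e. the root with $\mathrm{Re}\sqrt{z}>0$. *)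

theory Defs
  imports Complex_Main
begin

text \<open>The sequence is indexed from 1; the value at index 0 is a filler outside the sequence,
  chosen as the one for which the recursion also holds at index 1.\<close>

fun fseq :: "nat \<Rightarrow> complex \<Rightarrow> complex" where
  "fseq 0 z = z"
| "fseq (Suc 0) z = 1 + (z - 1) / (1 + z)"
| "fseq (Suc (Suc n)) z = 1 + (z - 1) / (1 + fseq (Suc n) z)"

text \<open>On the right half-plane \<^const>\<open>csqrt\<close> is the root with positive real part.\<close>

lemma csqrt_right_half_plane:
  assumes "Re z > 0"
  shows "(csqrt z)\<^sup>2 = z" and "Re (csqrt z) > 0"
proof -
  show "(csqrt z)\<^sup>2 = z" by (rule power2_csqrt)
  have "cmod z + Re z > 0" using assms by (simp add: add_nonneg_pos)
  then show "Re (csqrt z) > 0" by simp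
qed

end

theory Submission
  imports Defs
begin

text \<open>Put s = csqrt z and q = (1 - s) / (1 + s). One step of the recursion is a Moebius map with
  fixed points s and -s, and in the coordinate (f - s) / (f + s) it is multiplication by q.
  The starting value z = s^2 has coordinate -q, which gives a closed form for the sequence;
  since s lies in the right half-plane, q lies in the unit disc.\<close>

text \<open>The imaginary part of \<open>s\<close> contributes equally to both squared moduli, so
  only the real parts decide which is larger.\<close>

lemma cmod_cayley_less_1:
  assumes "Re s > 0"
  shows "cmod ((1 - s) / (1 + s)) < 1"
proof -
  have "(1 - Re s)\<^sup>2 < (1 + Re s)\<^sup>2"
    using assms by (simp add: power2_eq_square algebra_simps)
  then have "(cmod (1 - s))\<^sup>2 < (cmod (1 + s))\<^sup>2"
    by (simp add: cmod_power2)
  then have "cmod (1 - s) < cmod (1 + s)"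
    using power_less_imp_less_base norm_ge_zero by blast
  moreover from this have "0 < cmod (1 + s)"
    using norm_ge_zero le_less_trans by blast
  ultimately show ?thesis
    by (simp add: norm_divide)
qed

text \<open>A bound independent of \<open>n\<close>: it keeps the denominators of the closed form
  away from 0 and lets one constant serve the whole sequence.\<close>

lemma one_plus_power_lower_bound:
  fixes q :: "'a::real_normed_div_algebra"
  assumes "norm q < 1"
  shows "1 - norm q \<le> norm (1 + q ^ Suc n)"
proof -
  have "norm (q ^ Suc n) \<le> norm q"
    using assms by (simp add: norm_mult norm_power mult_left_le power_le_one)
  moreover have "1 - norm (q ^ Suc n) \<le> norm (1 + q ^ Suc n)"
    using norm_diff_ineq[of 1 "q ^ Suc n"] by simp
  ultimately show ?thesis by linarith
qed

lemma fseq_Suc: "fseq (Suc n) z = 1 + (z - 1) / (1 + fseq n z)"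
  by (cases n) simp_all

text \<open>This is (f - s) / (f + s) = -q^(n+1) solved for f. The exponent is \<open>Suc n\<close>
  because the filler at index 0 already has coordinate -q.\<close>

lemma fseq_closed_form:
  fixes s :: complex
  assumes "Re s > 0"
  defines "q \<equiv> (1 - s) / (1 + s)"
  shows "fseq n (s\<^sup>2) = s * (1 - q ^ Suc n) / (1 + q ^ Suc n)"
proof -
  have s1: "1 + s \<noteq> 0"
    using assms(1) by (auto simp: complex_eq_iff)
  have q: "q * (1 + s) = 1 - s"
    using s1 by (simp add: q_def)
  have q1: "cmod q < 1"
    using cmod_cayley_less_1[OF assms(1)] by (simp add: q_def)
  have nz: "1 + q ^ Suc m \<noteq> 0" for m
    using one_plus_power_lower_bound[OF q1, of m] q1 by force
  show ?thesis
  proof (induction n)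
    case 0
    \<comment> \<open>Since (1 + q)(1 + s) = 2 and (1 - q)(1 + s) = 2s, both sides equal
      2s^2.\<close>
    have "s\<^sup>2 * (1 + q) * (1 + s) = s * (1 - q) * (1 + s)"
      using q by algebra
    then have "s\<^sup>2 * (1 + q) = s * (1 - q)"
      using s1 by (simp only: mult_right_cancel[OF s1])
    then show ?case
      using nz[of 0] by (simp add: eq_divide_eq)
  next
    case (Suc n)
    define p where "p = q ^ Suc n"
    have p: "1 + p \<noteq> 0" "1 + q * p \<noteq> 0"
      using nz[of n] nz[of "Suc n"] by (simp_all add: p_def)
    have "1 + s * (1 - p) / (1 + p) = ((1 + p) + s * (1 - p)) / (1 + p)"
      using p by (simp add: field_simps)
    \<comment> \<open>Replacing q(1 + s) by 1 - s exposes the factor 1 + s, which then cancels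
      against s^2 - 1 = (1 + s)(s - 1).\<close>
    also have "(1 + p) + s * (1 - p) = (1 + s) * (1 + q * p)"
      using q by algebra
    finally have "fseq (Suc n) (s\<^sup>2) = 1 + (s\<^sup>2 - 1) / ((1 + s) * (1 + q * p) / (1 + p))"
      using Suc.IH by (simp add: fseq_Suc p_def)
    also have "s\<^sup>2 - 1 = (1 + s) * (s - 1)"
      by algebra
    also have "1 + (1 + s) * (s - 1) / ((1 + s) * (1 + q * p) / (1 + p))
        = ((1 + q * p) + (s - 1) * (1 + p)) / (1 + q * p)"
      using p s1 by (simp add: add_divide_distrib)
    \<comment> \<open>The two sides differ by p(q(1 + s) + s - 1), which is 0.\<close>
    also have "(1 + q * p) + (s - 1) * (1 + p) = s * (1 - q * p)"
      using q by algebra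
    finally show ?case
      by (simp add: p_def)
  qed
qed

theorem theorem1:
  fixes z :: complex
  assumes "Re z > 0"
  shows "(\<exists>C::real. C > 0 \<and>
            (\<forall>n\<ge>1. cmod (fseq n z - csqrt z) \<le> C * cmod ((1 - csqrt z) / (1 + csqrt z)) ^ n))
         \<and> (\<lambda>n. fseq n z) \<longlonglongrightarrow> csqrt z"
proof -
  define s where "s = csqrt z"
  define q where "q = (1 - s) / (1 + s)"
  \<comment> \<open>The error is exactly 2|s||q|^(n+1) / |1 + q^(n+1)|; \<open>C\<close> comes from
    bounding the denominator below by 1 - |q|.\<close>
  define C where "C = 2 * cmod s / (1 - cmod q)"
  have s: "s\<^sup>2 = z" "Re s > 0"
    using csqrt_right_half_plane[OF assms] by (simp_all only: s_def)
  have q1: "cmod q < 1"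
    using cmod_cayley_less_1[OF s(2)] by (simp add: q_def)
  have "s \<noteq> 0"
    using s(2) by auto
  then have C: "C > 0"
    using q1 by (simp add: C_def)
  have bound: "cmod (fseq n z - s) \<le> C * cmod q ^ n" for n
  proof -
    have d: "1 - cmod q \<le> cmod (1 + q ^ Suc n)"
      by (rule one_plus_power_lower_bound[OF q1])
    then have nz: "1 + q ^ Suc n \<noteq> 0"
      using q1 by force
    have "fseq n z - s = s * (1 - q ^ Suc n) / (1 + q ^ Suc n) - s"
      using fseq_closed_form[OF s(2), of n] by (simp only: s(1) q_def)
    also have "\<dots> = - (2 * s * q ^ Suc n) / (1 + q ^ Suc n)"
      using nz by (simp add: divide_simps) (simp add: algebra_simps)
    finally have "cmod (fseq n z - s) = 2 * cmod s * cmod q ^ Suc n / cmod (1 + q ^ Suc n)"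
      by (simp add: norm_divide norm_mult norm_power)
    \<comment> \<open>One factor |q| < 1 is given away here to reach the exponent
      \<open>n\<close>.\<close>
    also have "\<dots> \<le> 2 * cmod s * cmod q ^ n / (1 - cmod q)"
      using q1 d by (intro frac_le mult_left_mono power_decreasing) auto
    finally show ?thesis
      by (simp add: C_def)
  qed
  have "(\<lambda>n. C * cmod q ^ n) \<longlonglongrightarrow> 0"
    using q1 by (intro tendsto_mult_right_zero LIMSEQ_power_zero) simp
  then have "(\<lambda>n. fseq n z - s) \<longlonglongrightarrow> 0"
    by (rule tendsto_0_le[where K = 1]) (use bound C in \<open>auto simp: abs_mult intro!: always_eventually\<close>)
  then have "(\<lambda>n. fseq n z) \<longlonglongrightarrow> s"
    by (rule LIM_zero_cancel)
  moreover have "\<exists>C>0. \<forall>n\<ge>1. cmod (fseq n z - s) \<le> C * cmod q ^ n"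
    using C bound by (intro exI[of _ C]) simp
  ultimately show ?thesis
    by (simp only: q_def s_def)
qed

end
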